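(* Let $E,A\in\mathbb{R}^{n\times n}$ with $E$ singular and $\lambda E+A$ non-singular for some $\lambda\in\mathbb{R}$, and let $(E_1,A_1)$ be the matrix pencil of a deflated DAE of $E\dot x=Ax+f$. If $E_1\neq 0$ then $$\operatorname{ind}(E_1,A_1)=\operatorname{ind}(E,A)-1 .$$
   Context: Kronecker index. The index $\operatorname{ind}(B)$ of a square matrix $B$ is the smallest integer $k\ge 0$ with $\operatorname{Ker}(B^k)=\operatorname{Ker}(B^{k+1})$ (with $B^0=I$). For a regular pencil $(E,A)$, i.e. one such that $\lambda E+A$ is non-singular for some $\lambda\in\mathbb{R}$, $\operatorname{ind}(E,A)$ is the index of $(\lambda E+A)^{-1}E$ for such a $\lambda$ (it does not depend on $\lambda$). Deflated pencil. Let $(E,A)$ be regular of size $n\times n$ with $\operatorname{rank}E=r$. Choose an invertible matrix $U$ and a permutation matrix $P$ such that $$U^{-1}EP=\begin{pmatrix} S & T \\ 0 & 0 \end{pmatrix},\qquad U^{-1}AP=\begin{pmatrix} K & L \\ M & N \end{pmatrix},$$ with $S,K\in\mathbb{R}^{r\times r}$, $T,L\in\mathbb{R}^{r\times(n-r)}$, $M\in\mathbb{R}^{(n-r)\times r}$ and $N\in\mathbb{R}^{(n-r)\times(n-r)}$ non-singular (such choices exist). The corresponding deflated DAE has pencil $(E_1,A_1)$ with $E_1=S-TN^{-1}M$ and $A_1=K-LN^{-1}M$, both in $\mathbb{R}^{r\times r}$; this pencil is again regular. *)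

theory Defs
  imports
    "Jordan_Normal_Form.Matrix_Kernel"
    "Jordan_Normal_Form.DL_Rank"
    "HOL-Combinatorics.Permutations"
begin

definition mat_index :: "real mat \<Rightarrow> nat" where
  "mat_index B = (LEAST k. mat_kernel (B ^\<^sub>m k) = mat_kernel (B ^\<^sub>m (k + 1)))"

text \<open>The underlying option value is \<open>None\<close> for singular matrices, so this is meaningful
  for invertible arguments only.\<close>
definition mat_inv :: "real mat \<Rightarrow> real mat" where
  "mat_inv B = the (mat_inverse B)"

definition regular_pencil :: "real mat \<Rightarrow> real mat \<Rightarrow> bool" where
  "regular_pencil E A \<longleftrightarrow> (\<exists>c::real. invertible_mat (c \<cdot>\<^sub>m E + A))"

text \<open>The value does not depend on the choice of the admissible shift \<open>c\<close>; for pencils that are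
  not regular it carries no meaning.\<close>
definition pencil_index :: "real mat \<Rightarrow> real mat \<Rightarrow> nat" where
  "pencil_index E A =
     (let c = (SOME c::real. invertible_mat (c \<cdot>\<^sub>m E + A))
      in mat_index (mat_inv (c \<cdot>\<^sub>m E + A) * E))"

definition permutation_mat :: "nat \<Rightarrow> real mat \<Rightarrow> bool" where
  "permutation_mat n P \<longleftrightarrow>
     (\<exists>p. p permutes {..<n} \<and> P = mat n n (\<lambda>(i, j). if i = p j then 1 else 0))"

text \<open>\<open>deflated_pencil n E A E1 A1\<close>: the pencil \<open>(E1, A1)\<close> arises from the \<open>n \<times> n\<close> pencil
  \<open>(E, A)\<close> for some admissible choice of \<open>U\<close> and \<open>P\<close>. Neither this choice nor \<open>(E1, A1)\<close>
  is unique, hence a relation.\<close>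
definition deflated_pencil ::
    "nat \<Rightarrow> real mat \<Rightarrow> real mat \<Rightarrow> real mat \<Rightarrow> real mat \<Rightarrow> bool" where
  "deflated_pencil n E A E1 A1 \<longleftrightarrow>
     (\<exists>r U P S T K L M N.
        r = vec_space.rank n E \<and>
        U \<in> carrier_mat n n \<and> invertible_mat U \<and> permutation_mat n P \<and>
        S \<in> carrier_mat r r \<and> T \<in> carrier_mat r (n - r) \<and>
        K \<in> carrier_mat r r \<and> L \<in> carrier_mat r (n - r) \<and>
        M \<in> carrier_mat (n - r) r \<and> N \<in> carrier_mat (n - r) (n - r) \<and> invertible_mat N \<and>
        mat_inv U * E * P = four_block_mat S T (0\<^sub>m (n - r) r) (0\<^sub>m (n - r) (n - r)) \<and>
        mat_inv U * A * P = four_block_mat K L M N \<and>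
        E1 = S - T * mat_inv N * M \<and> A1 = K - L * mat_inv N * M)"

end

theory Submission
  imports Defs
begin

text \<open>Fix an admissible shift \<open>c\<close>. The deflation data provide a full rank factorization
  \<open>E = X W\<close> with \<open>r = rank E\<close> columns in \<open>X\<close>. With \<open>Y = (c E + A)\<^sup>-\<^sup>1 X\<close> one has
  \<open>(c E + A)\<^sup>-\<^sup>1 E = Y W\<close>, while a block computation gives \<open>W Y = E1 (c E1 + A1)\<^sup>-\<^sup>1\<close>, which is
  similar to \<open>(c E1 + A1)\<^sup>-\<^sup>1 E1\<close>. As \<open>(Y W)^(k+1) = Y (W Y)^k W\<close> with \<open>Y\<close> injective and \<open>W\<close>
  surjective, the index of \<open>Y W\<close> exceeds that of \<open>W Y\<close> by one. By the Schur complement formula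
  for determinants both pencils have the same admissible shifts, so the two choices of \<open>c\<close> made
  by \<open>pencil_index\<close> coincide.\<close>

section \<open>Invertibility, determinants and permutation matrices\<close>

lemma invertible_mat_iff_det:
  fixes A :: "'a :: field mat"
  assumes A: "A \<in> carrier_mat n n"
  shows "invertible_mat A \<longleftrightarrow> det A \<noteq> 0"
proof
  assume "invertible_mat A"
  then obtain B where AB: "A * B = 1\<^sub>m n" and "B * A = 1\<^sub>m (dim_row B)"
    using A unfolding invertible_mat_def inverts_mat_def by auto
  \<comment> \<open>\<open>inverts_mat\<close> leaves the shape of \<open>B\<close> open; comparing
    column counts in the two products gives \<open>dim_col B = n\<close> and
    \<open>dim_row B = n\<close>.\<close>
  then have "B \<in> carrier_mat n n"
    using A by (metis carrier_matD carrier_matI index_mult_mat(2,3) index_one_mat(2,3))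
  from det_mult[OF A this] AB show "det A \<noteq> 0" by auto
next
  assume "det A \<noteq> 0"
  from det_non_zero_imp_unit[OF A this, of "()"] obtain B
    where "B \<in> carrier_mat n n" "A * B = 1\<^sub>m n" "B * A = 1\<^sub>m n"
    unfolding Units_def ring_mat_def by auto
  then show "invertible_mat A"
    using A unfolding invertible_mat_def inverts_mat_def by auto
qed

lemma mat_inv:
  assumes A: "A \<in> carrier_mat n n" and inv: "invertible_mat A"
  shows "mat_inv A \<in> carrier_mat n n" "A * mat_inv A = 1\<^sub>m n" "mat_inv A * A = 1\<^sub>m n"
proof -
  have "A \<in> Units (ring_mat TYPE(real) n ())"
    using inv unfolding invertible_mat_iff_det[OF A] by (rule det_non_zero_imp_unit[OF A])
  then have "mat_inverse A \<noteq> None" using mat_inverse(1)[OF A, of "()"] by blast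
  then obtain B where "mat_inverse A = Some B" by auto
  with mat_inverse(2)[OF A this]
  show "mat_inv A \<in> carrier_mat n n" "A * mat_inv A = 1\<^sub>m n" "mat_inv A * A = 1\<^sub>m n"
    unfolding mat_inv_def by auto
qed

lemma permutation_mat_invertible:
  assumes "permutation_mat n P"
  shows "P \<in> carrier_mat n n" "invertible_mat P"
proof -
  from assms obtain p where p: "p permutes {..<n}"
    and P: "P = mat n n (\<lambda>(i, j). if i = p j then 1 else 0)"
    unfolding permutation_mat_def by auto
  show c: "P \<in> carrier_mat n n" unfolding P by simp
  \<comment> \<open>Column \<open>j\<close> of \<open>P\<close> is the unit vector at
    \<open>p j\<close>; injectivity of \<open>p\<close> makes the columns orthonormal.\<close>
  have "P\<^sup>T * P = 1\<^sub>m n"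
  proof (rule eq_matI)
    fix i j assume "i < dim_row (1\<^sub>m n)" "j < dim_col (1\<^sub>m n)"
    then have ij: "i < n" "j < n" by auto
    have "(P\<^sup>T * P) $$ (i, j)
        = (\<Sum>k = 0..<n. (if k = p i then 1 else 0) * (if k = p j then 1 else 0))"
      using ij unfolding P by (auto simp: scalar_prod_def intro!: sum.cong)
    also have "\<dots> = (if p i = p j then 1 else 0)"
      using permutes_in_image[OF p, of i] ij
      by (simp add: if_distrib[of "\<lambda>x. x * _"] cong: if_cong)
    also have "\<dots> = 1\<^sub>m n $$ (i, j)"
      using ij permutes_inj[OF p] by (auto simp: inj_eq)
    finally show "(P\<^sup>T * P) $$ (i, j) = 1\<^sub>m n $$ (i, j)" .
  qed (auto simp: P)
  then have "det P\<^sup>T * det P = 1"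
    using det_mult[of "P\<^sup>T" n P] c by simp
  then show "invertible_mat P" unfolding invertible_mat_iff_det[OF c] by auto
qed

section \<open>Powers of a matrix and stabilization of their kernels\<close>

lemma pow_mat_add:
  fixes A :: "'a :: semiring_1 mat"
  assumes A: "A \<in> carrier_mat n n"
  shows "A ^\<^sub>m (i + j) = A ^\<^sub>m i * A ^\<^sub>m j"
proof (induction j)
  case 0
  then show ?case using A by simp
next
  case (Suc j)
  then show ?case using assoc_mult_mat[OF pow_carrier_mat[OF A] pow_carrier_mat[OF A] A] by simp
qed

text \<open>A vector \<open>x\<close> in the kernel of \<open>B^(n+1)\<close> but not of \<open>B^n\<close> is impossible: apply a suitable
  power of \<open>B\<close> to a linear relation between \<open>x, B x, ..., B^n x\<close> such that only one term survives.\<close>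
lemma mat_kernel_pow_stabilizes:
  fixes B :: "'a :: field mat"
  assumes B: "B \<in> carrier_mat n n"
  shows "mat_kernel (B ^\<^sub>m n) = mat_kernel (B ^\<^sub>m (n + 1))"
proof (rule equalityI)
  have Bk: "B ^\<^sub>m k \<in> carrier_mat n n" for k using B by simp
  have pow_comm: "B ^\<^sub>m (i + j) *\<^sub>v x = B ^\<^sub>m i *\<^sub>v (B ^\<^sub>m j *\<^sub>v x)" if "x \<in> carrier_vec n" for i j x
    unfolding pow_mat_add[OF B] using Bk Bk that by (rule assoc_mult_mat_vec)
  have zero: "B ^\<^sub>m k *\<^sub>v 0\<^sub>v n = 0\<^sub>v n" for k
    using Bk[of k] by (intro eq_vecI) (auto simp: scalar_prod_def)
  show "mat_kernel (B ^\<^sub>m n) \<subseteq> mat_kernel (B ^\<^sub>m (n + 1))"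
  proof
    fix x assume "x \<in> mat_kernel (B ^\<^sub>m n)"
    then have x: "x \<in> carrier_vec n" "B ^\<^sub>m n *\<^sub>v x = 0\<^sub>v n" using mat_kernelD[OF Bk] by auto
    have "B ^\<^sub>m (n + 1) *\<^sub>v x = B ^\<^sub>m 1 *\<^sub>v (B ^\<^sub>m n *\<^sub>v x)"
      using pow_comm[OF x(1), of 1 n] by (simp add: add.commute)
    also have "\<dots> = 0\<^sub>v n" unfolding x(2) by (rule zero)
    finally show "x \<in> mat_kernel (B ^\<^sub>m (n + 1))" using mat_kernelI[OF Bk] x by blast
  qed
  show "mat_kernel (B ^\<^sub>m (n + 1)) \<subseteq> mat_kernel (B ^\<^sub>m n)"
  proof
    fix x assume "x \<in> mat_kernel (B ^\<^sub>m (n + 1))"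
    then have x: "x \<in> carrier_vec n" and x0: "B ^\<^sub>m (n + 1) *\<^sub>v x = 0\<^sub>v n"
      using mat_kernelD[OF Bk, of x "n + 1"] by blast+
    have high: "B ^\<^sub>m k *\<^sub>v x = 0\<^sub>v n" if "k > n" for k
    proof -
      have "B ^\<^sub>m k *\<^sub>v x = B ^\<^sub>m (k - (n + 1)) *\<^sub>v (B ^\<^sub>m (n + 1) *\<^sub>v x)"
        using pow_comm[OF x, of "k - (n + 1)" "n + 1"] that by simp
      also have "\<dots> = 0\<^sub>v n" unfolding x0 by (rule zero)
      finally show ?thesis .
    qed
    \<comment> \<open>The columns of \<open>C\<close> are x, B x, ..., B^n x, that is n + 1 vectors
      in dimension n. The zero row appended in \<open>D\<close> makes the matrix square and
      singular, so a linear relation \<open>v\<close> comes from the determinant criterion.\<close>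
    define C where "C = mat n (n + 1) (\<lambda>(i, j). (B ^\<^sub>m j *\<^sub>v x) $ i)"
    define D where "D = mat (n + 1) (n + 1) (\<lambda>(i, j). if i < n then C $$ (i, j) else 0)"
    have C: "C \<in> carrier_mat n (n + 1)" and D: "D \<in> carrier_mat (n + 1) (n + 1)"
      unfolding C_def D_def by auto
    have "D\<^sup>T *\<^sub>v unit_vec (n + 1) n = 0\<^sub>v (n + 1)"
      unfolding D_def by (intro eq_vecI) auto
    then have "det D\<^sup>T = 0"
      using det_0_iff_vec_prod_zero[of "D\<^sup>T" "n + 1"] D
      by (metis less_add_one transpose_carrier_mat unit_vec_carrier unit_vec_nonzero)
    then have "det D = 0" using det_transpose[OF D] by simp
    then obtain v where v: "v \<in> carrier_vec (n + 1)" "v \<noteq> 0\<^sub>v (n + 1)" and Dv: "D *\<^sub>v v = 0\<^sub>v (n + 1)"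
      using det_0_iff_vec_prod_zero[OF D] by auto
    have Cv: "C *\<^sub>v v = 0\<^sub>v n"
    proof (rule eq_vecI)
      fix i assume "i < dim_vec (0\<^sub>v n)"
      then have i: "i < n" by simp
      then have "row C i = row D i" unfolding D_def C_def by (intro eq_vecI) auto
      then have "(C *\<^sub>v v) $ i = (D *\<^sub>v v) $ i" using i C D by simp
      then show "(C *\<^sub>v v) $ i = 0\<^sub>v n $ i" unfolding Dv using i by simp
    qed (use C in auto)
    \<comment> \<open>\<open>i\<close> is the first index with nonzero coefficient. After
      multiplication by B^(n-i) the terms j < i vanish by minimality, the terms j > i because their
      exponent exceeds n, and j = i leaves a nonzero multiple of B^n x.\<close>
    have "\<exists>i. i < n + 1 \<and> v $ i \<noteq> 0" using v by (metis eq_vecI carrier_vecD index_zero_vec)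
    then obtain i where i: "i < n + 1" "v $ i \<noteq> 0" and least: "\<And>j. j < i \<Longrightarrow> v $ j = 0"
      using exists_least_iff[of "\<lambda>i. i < n + 1 \<and> v $ i \<noteq> 0"] by auto
    have BC: "B ^\<^sub>m k * C = mat n (n + 1) (\<lambda>(l, j). (B ^\<^sub>m (k + j) *\<^sub>v x) $ l)" for k
    proof (rule eq_matI)
      fix l j
      assume "l < dim_row (mat n (n + 1) (\<lambda>(l, j). (B ^\<^sub>m (k + j) *\<^sub>v x) $ l))"
        and "j < dim_col (mat n (n + 1) (\<lambda>(l, j). (B ^\<^sub>m (k + j) *\<^sub>v x) $ l))"
      then have lj: "l < n" "j < n + 1" by auto
      have "col C j = B ^\<^sub>m j *\<^sub>v x" using lj Bk[of j] unfolding C_def by (intro eq_vecI) auto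
      then have "(B ^\<^sub>m k * C) $$ (l, j) = (B ^\<^sub>m k *\<^sub>v (B ^\<^sub>m j *\<^sub>v x)) $ l"
        using lj C B by simp
      then show "(B ^\<^sub>m k * C) $$ (l, j) = mat n (n + 1) (\<lambda>(l, j). (B ^\<^sub>m (k + j) *\<^sub>v x) $ l) $$ (l, j)"
        using lj pow_comm[OF x] by simp
    qed (use B C in auto)
    have "B ^\<^sub>m n *\<^sub>v x = 0\<^sub>v n"
    proof (rule eq_vecI)
      fix l assume "l < dim_vec (0\<^sub>v n)"
      then have l: "l < n" by simp
      have "(B ^\<^sub>m (n - i) * C) *\<^sub>v v = B ^\<^sub>m (n - i) *\<^sub>v (C *\<^sub>v v)"
        using Bk C v(1) by (rule assoc_mult_mat_vec)
      also have "\<dots> = 0\<^sub>v n" unfolding Cv by (rule zero)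
      finally have "((B ^\<^sub>m (n - i) * C) *\<^sub>v v) $ l = 0" using l by simp
      then have "0 = (\<Sum>j = 0..<n + 1. (B ^\<^sub>m (n - i + j) *\<^sub>v x) $ l * v $ j)"
        using l v(1) unfolding BC by (simp add: scalar_prod_def)
      also have "\<dots> = (\<Sum>j = 0..<n + 1. if j = i then (B ^\<^sub>m n *\<^sub>v x) $ l * v $ i else 0)"
      proof (rule sum.cong[OF refl])
        fix j
        consider "j < i" | "j = i" | "j > i" by linarith
        then show "(B ^\<^sub>m (n - i + j) *\<^sub>v x) $ l * v $ j
            = (if j = i then (B ^\<^sub>m n *\<^sub>v x) $ l * v $ i else 0)"
        proof cases
          case 3
          then have "n - i + j > n" using i(1) by linarith
          from high[OF this] show ?thesis using 3 l by simp
        qed (use i(1) least in auto)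
      qed
      also have "\<dots> = (B ^\<^sub>m n *\<^sub>v x) $ l * v $ i" using i(1) by simp
      finally show "(B ^\<^sub>m n *\<^sub>v x) $ l = 0\<^sub>v n $ l" using i(2) l by simp
    qed (use B in auto)
    then show "x \<in> mat_kernel (B ^\<^sub>m n)" using mat_kernelI[OF Bk] x by blast
  qed
qed

section \<open>Kernel comparison, and the index under similarity and exchange of factors\<close>

text \<open>Left multiplication can only enlarge a kernel; doing it with \<open>Y\<close> and then
  with its left inverse \<open>L\<close> gives both inclusions.\<close>

lemma mat_kernel_left_cancel:
  assumes L: "L \<in> carrier_mat m n" and Y: "Y \<in> carrier_mat n m" and LY: "L * Y = 1\<^sub>m m"
    and A: "A \<in> carrier_mat m k"
  shows "mat_kernel (Y * A) = mat_kernel A"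
proof
  have "L * (Y * A) = A" using assoc_mult_mat[OF L Y A] LY A by simp
  then show "mat_kernel (Y * A) \<subseteq> mat_kernel A"
    using mat_kernel_mult_subset[OF mult_carrier_mat[OF Y A] L] by simp
qed (rule mat_kernel_mult_subset[OF A Y])

text \<open>The kernel of \<open>A * W\<close> is the preimage of the kernel of \<open>A\<close>
  under \<open>W\<close>, and preimages under a surjective map determine the original sets. Unlike
  in left cancellation, the kernels themselves change and only comparisons between them
  survive.\<close>

lemma mat_kernel_right_cancel:
  assumes W: "W \<in> carrier_mat r n" and R: "R \<in> carrier_mat n r" and WR: "W * R = 1\<^sub>m r"
    and A: "A \<in> carrier_mat m r" and A': "A' \<in> carrier_mat m' r"
  shows "mat_kernel (A * W) = mat_kernel (A' * W) \<longleftrightarrow> mat_kernel A = mat_kernel A'"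
proof -
  have pre: "x \<in> mat_kernel (D * W) \<longleftrightarrow> x \<in> carrier_vec n \<and> W *\<^sub>v x \<in> mat_kernel D"
    if D: "D \<in> carrier_mat l r" for D l x
    using D W mat_kernel[OF D] mat_kernel[OF mult_carrier_mat[OF D W]] by auto
  have surj: "R *\<^sub>v y \<in> carrier_vec n \<and> W *\<^sub>v (R *\<^sub>v y) = y" if "y \<in> carrier_vec r" for y
    using that R assoc_mult_mat_vec[OF W R that] WR by simp
  have "mat_kernel D \<subseteq> mat_kernel D'"
    if sub: "mat_kernel (D * W) \<subseteq> mat_kernel (D' * W)"
      and D: "D \<in> carrier_mat l r" and D': "D' \<in> carrier_mat l' r" for D D' l l'
  proof
    fix y assume y: "y \<in> mat_kernel D"
    then have "y \<in> carrier_vec r" using mat_kernel_carrier[OF D] by blast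
    note Ry = surj[OF this]
    then have "R *\<^sub>v y \<in> mat_kernel (D * W)" using y pre[OF D] by simp
    then have "R *\<^sub>v y \<in> mat_kernel (D' * W)" using sub by blast
    then show "y \<in> mat_kernel D'" using Ry pre[OF D'] by simp
  qed
  from this[OF _ A A'] this[OF _ A' A] show ?thesis using pre[OF A] pre[OF A'] by auto
qed

text \<open>Powers of the conjugate are \<open>F * A ^\<^sub>m k * G\<close>; \<open>F\<close>
  cancels inside each kernel and \<open>G\<close> cancels in each comparison of kernels, so the same
  exponents qualify.\<close>

lemma mat_index_similar:
  assumes A: "A \<in> carrier_mat n n" and F: "F \<in> carrier_mat n n" and G: "G \<in> carrier_mat n n"
    and FG: "F * G = 1\<^sub>m n" and GF: "G * F = 1\<^sub>m n"
  shows "mat_index (F * A * G) = mat_index A"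
proof -
  have FAG: "F * A * G \<in> carrier_mat n n" using A F G by simp
  have "similar_mat_wit (F * A * G) A F G"
    using A F G FG GF FAG by (intro similar_mat_witI) auto
  note wit = similar_mat_wit_pow[OF this]
  have pow: "(F * A * G) ^\<^sub>m k = F * A ^\<^sub>m k * G" for k
    by (rule similar_mat_witD2(3)[OF pow_carrier_mat[OF FAG] wit])
  have "mat_kernel (F * A ^\<^sub>m k * G) = mat_kernel (A ^\<^sub>m k * G)" for k
  proof -
    have "A ^\<^sub>m k * G \<in> carrier_mat n n" by (rule mult_carrier_mat[OF pow_carrier_mat[OF A] G])
    from mat_kernel_left_cancel[OF G F GF this]
    show ?thesis using assoc_mult_mat[OF F pow_carrier_mat[OF A] G] by simp
  qed
  moreover have "mat_kernel (A ^\<^sub>m k * G) = mat_kernel (A ^\<^sub>m l * G)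
      \<longleftrightarrow> mat_kernel (A ^\<^sub>m k) = mat_kernel (A ^\<^sub>m l)" for k l
    using A by (intro mat_kernel_right_cancel[OF G F GF]) auto
  ultimately show ?thesis unfolding mat_index_def pow by presburger
qed

text \<open>Regrouping of the alternating product: the outer \<open>Y\<close> and \<open>W\<close>
  can then be cancelled in kernel comparisons, which lowers the exponent by one.\<close>

lemma pow_mat_mult_Suc:
  fixes Y W :: "'a :: semiring_1 mat"
  assumes Y: "Y \<in> carrier_mat n r" and W: "W \<in> carrier_mat r n"
  shows "(Y * W) ^\<^sub>m Suc k = Y * ((W * Y) ^\<^sub>m k * W)"
proof (induction k)
  case 0
  then show ?case using Y W by simp
next
  case (Suc k)
  have c: "W * Y \<in> carrier_mat r r" "(W * Y) ^\<^sub>m k \<in> carrier_mat r r" using Y W by auto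
  have "(Y * W) ^\<^sub>m Suc (Suc k) = Y * ((W * Y) ^\<^sub>m k * W) * (Y * W)" using Suc by simp
  also have "\<dots> = Y * ((W * Y) ^\<^sub>m k * W * (Y * W))"
    using Y W c by (intro assoc_mult_mat) auto
  also have "(W * Y) ^\<^sub>m k * W * (Y * W) = (W * Y) ^\<^sub>m k * (W * (Y * W))"
    using Y W c by (intro assoc_mult_mat) auto
  also have "W * (Y * W) = W * Y * W" using assoc_mult_mat[OF W Y W] by simp
  also have "(W * Y) ^\<^sub>m k * (W * Y * W) = (W * Y) ^\<^sub>m Suc k * W"
    using assoc_mult_mat[OF c(2,1) W] by simp
  finally show ?case .
qed

text \<open>\<open>L\<close> and \<open>R\<close> witness that \<open>Y\<close> is injective and
  \<open>W\<close> surjective. The shift relates only positive exponents of \<open>Y * W\<close> to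
  exponents of \<open>W * Y\<close>; singularity is what excludes exponent 0.\<close>

lemma mat_index_mult_swap:
  assumes Y: "Y \<in> carrier_mat n r" and W: "W \<in> carrier_mat r n"
    and L: "L \<in> carrier_mat r n" and LY: "L * Y = 1\<^sub>m r"
    and R: "R \<in> carrier_mat n r" and WR: "W * R = 1\<^sub>m r"
    and sing: "\<not> invertible_mat (Y * W)"
  shows "mat_index (Y * W) = Suc (mat_index (W * Y))"
proof -
  let ?B = "Y * W" and ?C = "W * Y"
  have B: "?B \<in> carrier_mat n n" and C: "?C \<in> carrier_mat r r" using Y W by auto
  have ker_Suc: "mat_kernel (?B ^\<^sub>m Suc k) = mat_kernel (?C ^\<^sub>m k * W)" for k
    unfolding pow_mat_mult_Suc[OF Y W]
    by (rule mat_kernel_left_cancel[OF L Y LY mult_carrier_mat[OF pow_carrier_mat[OF C] W]])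
  have shift: "mat_kernel (?B ^\<^sub>m Suc k) = mat_kernel (?B ^\<^sub>m (Suc k + 1))
      \<longleftrightarrow> mat_kernel (?C ^\<^sub>m k) = mat_kernel (?C ^\<^sub>m (k + 1))" for k
  proof -
    have "mat_kernel (?C ^\<^sub>m k * W) = mat_kernel (?C ^\<^sub>m Suc k * W)
        \<longleftrightarrow> mat_kernel (?C ^\<^sub>m k) = mat_kernel (?C ^\<^sub>m Suc k)"
      by (rule mat_kernel_right_cancel[OF W R WR, of _ r _ r])
        (rule pow_carrier_mat[OF C])+
    moreover have "Suc k + 1 = Suc (Suc k)" by simp
    ultimately show ?thesis unfolding \<open>Suc k + 1 = Suc (Suc k)\<close> ker_Suc by simp
  qed
  \<comment> \<open>A nonzero vector killed by \<open>?B\<close> separates the trivial kernel of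
    \<open>?B ^\<^sub>m 0\<close> from that of \<open>?B\<close>.\<close>
  obtain v where v: "v \<in> carrier_vec n" "v \<noteq> 0\<^sub>v n" "?B *\<^sub>v v = 0\<^sub>v n"
    using sing invertible_mat_iff_det[OF B] det_0_iff_vec_prod_zero[OF B] by auto
  have "v \<in> mat_kernel (?B ^\<^sub>m (0 + 1))" using v B Y mat_kernelI[OF B] by simp
  moreover have "v \<notin> mat_kernel (?B ^\<^sub>m 0)"
    using v Y mat_kernelD(2)[of "1\<^sub>m n" n n v] by auto
  ultimately have "mat_kernel (?B ^\<^sub>m 0) \<noteq> mat_kernel (?B ^\<^sub>m (0 + 1))" by blast
  \<comment> \<open>Stabilization at exponent \<open>r\<close> guarantees that both
    \<open>LEAST\<close> expressions have a witness: \<open>r\<close> for \<open>?C\<close>, and by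
    the shift \<open>Suc r\<close> for \<open>?B\<close>.\<close>
  moreover have "mat_kernel (?C ^\<^sub>m r) = mat_kernel (?C ^\<^sub>m (r + 1))"
    by (rule mat_kernel_pow_stabilizes[OF C])
  ultimately show ?thesis unfolding mat_index_def
    using shift by (intro Least_Suc2[of _ "Suc r" _ r]) auto
qed

section \<open>Rank and one-sided inverses in a full rank factorization\<close>

text \<open>\<open>J\<close> selects columns of \<open>A\<close> that form a maximal independent
  set; a vector killed by \<open>A * J\<close> would be a linear relation among them.\<close>

lemma (in vec_space) rank_obtain_injective_cols:
  assumes A: "A \<in> carrier_mat n nc"
  obtains J where "J \<in> carrier_mat nc (rank A)"
    and "\<And>v. v \<in> carrier_vec (rank A) \<Longrightarrow> A * J *\<^sub>v v = 0\<^sub>v n \<Longrightarrow> v = 0\<^sub>v (rank A)"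
proof -
  obtain S where S: "maximal S (\<lambda>T. T \<subseteq> set (cols A) \<and> lin_indpt T)"
    using maximal_exists[of "\<lambda>T. T \<subseteq> set (cols A) \<and> lin_indpt T" "card (set (cols A))" "{}"]
    by (meson List.finite_set card_mono empty_iff empty_subsetI finite_lin_indpt2 rev_finite_subset)
  then have sub: "S \<subseteq> set (cols A)" and indpt: "lin_indpt S" unfolding maximal_def by auto
  have card: "card S = rank A" using rank_card_indpt[OF A S] by simp
  have "finite S" using sub finite_subset by blast
  \<comment> \<open>Independence is a property of the set \<open>S\<close>; listing it without
    repetition turns it into injectivity of the matrix with these columns.\<close>
  then obtain ss where ss: "set ss = S" "distinct ss" "length ss = rank A"
    using finite_distinct_list[of S] distinct_card card by metis
  have "\<exists>j. j < nc \<and> ss ! i = col A j" if "i < rank A" for i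
  proof -
    have "ss ! i \<in> set (cols A)" using that ss sub by auto
    then show ?thesis using A by (auto simp: in_set_conv_nth)
  qed
  then obtain f where f: "\<And>i. i < rank A \<Longrightarrow> f i < nc \<and> ss ! i = col A (f i)" by metis
  define J :: "'a mat" where "J = mat_of_cols nc (map (\<lambda>i. unit_vec nc (f i)) [0..<rank A])"
  have J: "J \<in> carrier_mat nc (rank A)" unfolding J_def by auto
  have dim: "set ss \<subseteq> carrier_vec n" using ss(1) sub cols_dim[of A] A by auto
  have AJ: "A * J = mat_of_cols n ss"
  proof (rule eq_matI)
    fix i j assume "i < dim_row (mat_of_cols n ss)" "j < dim_col (mat_of_cols n ss)"
    then have ij: "i < n" "j < rank A" using ss by auto
    have "col J j = unit_vec nc (f j)" unfolding J_def using ij by simp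
    then show "(A * J) $$ (i, j) = mat_of_cols n ss $$ (i, j)"
      using ij A J f[OF ij(2)] ss(3) by (simp add: mat_of_cols_index)
  qed (use A J ss in auto)
  have AJc: "A * J \<in> carrier_mat n (rank A)" using A J by simp
  have cols: "cols (A * J) = ss" unfolding AJ using dim by simp
  show thesis
  proof (rule that[OF J])
    fix v assume "v \<in> carrier_vec (rank A)" "A * J *\<^sub>v v = 0\<^sub>v n"
    then show "v = 0\<^sub>v (rank A)"
      using lin_depI[OF AJc] indpt ss unfolding cols by metis
  qed
qed

text \<open>With \<open>J\<close> selecting r independent columns of \<open>X * W\<close>, the
  square matrix \<open>W * J\<close> is injective, hence invertible, and \<open>J\<close> times its
  inverse is the required \<open>R\<close>.\<close>

lemma (in vec_space) rank_factorization_right_inverse: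
  assumes X: "X \<in> carrier_mat n r" and W: "W \<in> carrier_mat r nc" and r: "rank (X * W) = r"
  obtains R where "R \<in> carrier_mat nc r" "W * R = 1\<^sub>m r"
proof -
  have XW: "X * W \<in> carrier_mat n nc" using X W by simp
  from rank_obtain_injective_cols[OF XW, unfolded r] obtain J
    where J: "J \<in> carrier_mat nc r"
      and inj: "\<And>v. v \<in> carrier_vec r \<Longrightarrow> X * W * J *\<^sub>v v = 0\<^sub>v n \<Longrightarrow> v = 0\<^sub>v r" by metis
  have WJ: "W * J \<in> carrier_mat r r" using W J by simp
  have "det (W * J) \<noteq> 0"
  proof
    assume "det (W * J) = 0"
    then obtain v where v: "v \<in> carrier_vec r" "v \<noteq> 0\<^sub>v r" "W * J *\<^sub>v v = 0\<^sub>v r"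
      using det_0_iff_vec_prod_zero[OF WJ] by auto
    have "X * W * J *\<^sub>v v = X *\<^sub>v (W * J *\<^sub>v v)"
      using assoc_mult_mat[OF X W J] assoc_mult_mat_vec[OF X WJ v(1)] by simp
    also have "\<dots> = 0\<^sub>v n" unfolding v(3) using X by (intro eq_vecI) auto
    finally show False using inj v by blast
  qed
  from det_non_zero_imp_unit[OF WJ this, of "()"] obtain D
    where D: "D \<in> carrier_mat r r" "W * J * D = 1\<^sub>m r"
    unfolding Units_def ring_mat_def by auto
  show thesis
    by (rule that[of "J * D"]) (use J D assoc_mult_mat[OF W J D(1)] in auto)
qed

section \<open>Block identities for the Schur complement\<close>

text \<open>\<open>J\<close> plays the role of N^-1 M. Empty blocks encode the block columns
  \<open>Z\<close> = (1; 0), \<open>Q\<close> = (1; -J) and the block row \<open>W\<close> = (S T),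
  so that the four-block product rule applies. The lower block row (M N) annihilates
  \<open>Q\<close> because M - N J = 0.\<close>

lemma deflation_blocks:
  fixes S T K L M N J :: "'a :: idom mat"
  assumes c: "S \<in> carrier_mat r r" "T \<in> carrier_mat r m" "K \<in> carrier_mat r r" "L \<in> carrier_mat r m"
      "M \<in> carrier_mat m r" "N \<in> carrier_mat m m" "J \<in> carrier_mat m r"
    and NJ: "N * J = M"
  defines "Z \<equiv> four_block_mat (1\<^sub>m r) (0\<^sub>m r 0) (0\<^sub>m m r) (0\<^sub>m m 0)"
    and "W \<equiv> four_block_mat S T (0\<^sub>m 0 r) (0\<^sub>m 0 m)"
    and "Q \<equiv> four_block_mat (1\<^sub>m r) (0\<^sub>m r 0) (- J) (0\<^sub>m m 0)"
    and "H \<equiv> four_block_mat K L M N"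
  shows "Z * W = four_block_mat S T (0\<^sub>m m r) (0\<^sub>m m m)"
    and "Z\<^sup>T * Z = 1\<^sub>m r"
    and "W * Q = S - T * J"
    and "H * Q = Z * (K - L * J)"
    and "det H = det (K - L * J) * det N"
proof -
  have LJ: "L * J \<in> carrier_mat r r" "T * J \<in> carrier_mat r r" using c by auto
  have col0: "four_block_mat B (0\<^sub>m r 0) (0\<^sub>m 0 r) (0\<^sub>m 0 0) = B" if "B \<in> carrier_mat r r" for B :: "'a mat"
    by (rule eq_matI) (use that in auto)
  have neg: "L * - J = - (L * J)" "T * - J = - (T * J)" "N * - J = - M"
    using c NJ by simp_all
  have MNJ: "M + N * - J = 0\<^sub>m m r"
    unfolding neg by (intro eq_matI) (use c in auto)
  have KL: "K + L * - J = K - L * J" "S + T * - J = S - T * J"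
    unfolding neg by (intro eq_matI; use c in auto)+
  show "Z * W = four_block_mat S T (0\<^sub>m m r) (0\<^sub>m m m)"
    unfolding Z_def W_def
    by (subst mult_four_block_mat[of _ r r _ 0 _ m _ _ r _ m]) (use c in auto)
  show "Z\<^sup>T * Z = 1\<^sub>m r"
    unfolding Z_def
    by (subst transpose_four_block_mat[of _ r r _ 0 _ m], auto)
      (subst mult_four_block_mat[of _ r r _ m _ 0 _ _ r _ 0], auto simp: col0)
  show "W * Q = S - T * J"
    unfolding W_def Q_def
    by (subst mult_four_block_mat[of _ r r _ m _ 0 _ _ r _ 0]) (use c KL col0 in auto)
  have HQ: "H * Q = four_block_mat (K - L * J) (0\<^sub>m r 0) (0\<^sub>m m r) (0\<^sub>m m 0)"
    unfolding H_def Q_def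
    by (subst mult_four_block_mat[of _ r r _ m _ m _ _ r _ 0]) (use c KL MNJ in auto)
  also have "\<dots> = Z * four_block_mat (K - L * J) (0\<^sub>m r 0) (0\<^sub>m 0 r) (0\<^sub>m 0 0)"
    unfolding Z_def
    by (subst mult_four_block_mat[of _ r r _ 0 _ m _ _ r _ 0]) (use c LJ in auto)
  also have "\<dots> = Z * (K - L * J)" using col0[OF minus_carrier_mat[OF LJ(1)]] by simp
  finally show "H * Q = Z * (K - L * J)" .
  \<comment> \<open>\<open>?G\<close> completes \<open>Q\<close> to a unit lower block triangular
    matrix: its determinant is 1 and it clears the block \<open>M\<close> of
    \<open>H\<close>.\<close>
  let ?G = "four_block_mat (1\<^sub>m r) (0\<^sub>m r m) (- J) (1\<^sub>m m)"
  have "H * ?G = four_block_mat (K - L * J) L (0\<^sub>m m r) N"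
    unfolding H_def
    by (subst mult_four_block_mat[of _ r r _ m _ m _ _ r _ m]) (use c KL MNJ in auto)
  moreover have "det (four_block_mat (K - L * J) L (0\<^sub>m m r) N) = det (K - L * J) * det N"
    by (rule det_four_block_mat_lower_left_zero[of _ r _ m]) (use c LJ in auto)
  moreover have "det ?G = 1"
    by (subst det_four_block_mat_upper_right_zero[of _ r _ m]) (use c in auto)
  moreover have "det (H * ?G) = det H * det ?G"
    by (rule det_mult[of _ "r + m"]) (use c in \<open>auto simp: H_def\<close>)
  ultimately show "det H = det (K - L * J) * det N" by simp
qed

section \<open>Transfer of the block identities to the pencils\<close>

theorem theorem5:
  fixes n :: nat and E A E1 A1 :: "real mat"
  assumes "E \<in> carrier_mat n n" and "A \<in> carrier_mat n n"
    and "\<not> invertible_mat E"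
    and "regular_pencil E A"
    and "deflated_pencil n E A E1 A1"
    and "E1 \<noteq> 0\<^sub>m (dim_row E1) (dim_col E1)"
  shows "int (pencil_index E1 A1) = int (pencil_index E A) - 1"
proof -
  note E = assms(1) and A = assms(2)
  from assms(5) obtain r U P S T K L M N where r: "r = vec_space.rank n E"
    and U: "U \<in> carrier_mat n n" "invertible_mat U" and perm: "permutation_mat n P"
    and STKL: "S \<in> carrier_mat r r" "T \<in> carrier_mat r (n - r)"
      "K \<in> carrier_mat r r" "L \<in> carrier_mat r (n - r)"
    and M: "M \<in> carrier_mat (n - r) r" and N: "N \<in> carrier_mat (n - r) (n - r)" "invertible_mat N"
    and UEP: "mat_inv U * E * P = four_block_mat S T (0\<^sub>m (n - r) r) (0\<^sub>m (n - r) (n - r))"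
    and UAP: "mat_inv U * A * P = four_block_mat K L M N"
    and E1: "E1 = S - T * mat_inv N * M" and A1: "A1 = K - L * mat_inv N * M"
    unfolding deflated_pencil_def by blast
  define m where "m = n - r"
  \<comment> \<open>The rank bound makes the truncated difference \<open>n - r\<close>
    exact.\<close>
  have "r \<le> n" unfolding r by (rule vec_space.rank_le_nc[OF E])
  then have n: "n = r + m" unfolding m_def by simp
  note STKL = STKL[folded m_def] and M = M[folded m_def] and N = N[folded m_def]
    and UEP = UEP[folded m_def]
  note P = permutation_mat_invertible[OF perm]
  note Ui = mat_inv[OF U] and Pi = mat_inv[OF P] and Ni = mat_inv[OF N]
  define J where "J = mat_inv N * M"
  have J: "J \<in> carrier_mat m r" and NJ: "N * J = M"
    unfolding J_def using M N(1) Ni assoc_mult_mat[OF N(1) Ni(1) M] by auto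
  have E1: "E1 = S - T * J" and A1: "A1 = K - L * J"
    unfolding E1 A1 J_def
    using assoc_mult_mat[OF STKL(2) Ni(1) M] assoc_mult_mat[OF STKL(4) Ni(1) M] by simp_all
  have E1c: "E1 \<in> carrier_mat r r" and A1c: "A1 \<in> carrier_mat r r"
    unfolding E1 A1
    by (intro minus_carrier_mat mult_carrier_mat[OF STKL(2) J] mult_carrier_mat[OF STKL(4) J])+
  \<comment> \<open>\<open>V\<close> is the block row called \<open>W\<close> in
    \<open>deflation_blocks\<close>; the name \<open>W\<close> is kept for the factor of
    \<open>E\<close>.\<close>
  define Z :: "real mat" where "Z = four_block_mat (1\<^sub>m r) (0\<^sub>m r 0) (0\<^sub>m m r) (0\<^sub>m m 0)"
  define V where "V = four_block_mat S T (0\<^sub>m 0 r) (0\<^sub>m 0 m)"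
  define Q where "Q = four_block_mat (1\<^sub>m r) (0\<^sub>m r 0) (- J) (0\<^sub>m m 0)"
  have Z: "Z \<in> carrier_mat n r" and V: "V \<in> carrier_mat r n" and Q: "Q \<in> carrier_mat n r"
    using four_block_carrier_mat[OF one_carrier_mat[of r] zero_carrier_mat[of m 0]]
      four_block_carrier_mat[OF STKL(1) zero_carrier_mat[of 0 m]]
    unfolding Z_def V_def Q_def n by simp_all
  define F where "F c = c \<cdot>\<^sub>m E1 + A1" for c :: real
  define D where "D c = c \<cdot>\<^sub>m E + A" for c :: real
  define H where "H c = four_block_mat (c \<cdot>\<^sub>m S + K) (c \<cdot>\<^sub>m T + L) M N" for c :: real
  have F: "F c \<in> carrier_mat r r" and D: "D c \<in> carrier_mat n n" and H: "H c \<in> carrier_mat n n" for c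
    unfolding F_def D_def H_def
    using E A E1c A1c n four_block_carrier_mat[OF add_carrier_mat[OF STKL(3)] N(1)] by simp_all
  \<comment> \<open>The lower block row of \<open>H c\<close> is independent of \<open>c\<close>,
    since the transformed \<open>E\<close> is zero there. Hence one \<open>J\<close> serves every
    shift, and \<open>F c\<close> is the Schur complement of \<open>N\<close> in
    \<open>H c\<close>.\<close>
  have F_Schur: "F c = c \<cdot>\<^sub>m S + K - (c \<cdot>\<^sub>m T + L) * J" for c
  proof -
    have "(c \<cdot>\<^sub>m T + L) * J = c \<cdot>\<^sub>m (T * J) + L * J"
      using STKL J by (subst add_mult_distrib_mat[of _ r m _ _ r]) auto
    then show ?thesis
      unfolding F_def E1 A1 by (intro eq_matI) (use STKL J in \<open>auto simp: algebra_simps\<close>)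
  qed
  note blocks = deflation_blocks[OF STKL(1,2) _ _ M N(1) J NJ, folded Z_def V_def Q_def]
  have HQ: "H c * Q = Z * F c" and detH: "det (H c) = det (F c) * det N" for c
    using blocks(4,5)[of "c \<cdot>\<^sub>m S + K" "c \<cdot>\<^sub>m T + L"] STKL unfolding H_def F_Schur by auto
  have UDP: "mat_inv U * D c * P = H c" for c
  proof -
    have "mat_inv U * D c * P = c \<cdot>\<^sub>m (mat_inv U * E * P) + mat_inv U * A * P"
      unfolding D_def using Ui(1) E A P(1)
      by (simp add: mult_add_distrib_mat[of _ n n _ n] add_mult_distrib_mat[of _ n n _ _ n]
          mult_smult_distrib[of _ n n _ n] mult_smult_assoc_mat[of _ n n _ n])
    also have "\<dots> = H c"
      unfolding UEP UAP H_def using STKL M N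
      by (subst smult_four_block_mat[of _ r r _ m _ m]) auto
    finally show ?thesis .
  qed
  have recover: "U * (mat_inv U * B * P) * mat_inv P = B" if B: "B \<in> carrier_mat n n" for B
  proof -
    have "U * (mat_inv U * B * P) * mat_inv P = U * (mat_inv U * B * P * mat_inv P)"
      using U Ui Pi P B by (intro assoc_mult_mat[of _ n n _ n _ n]) auto
    also have "mat_inv U * B * P * mat_inv P = mat_inv U * B * (P * mat_inv P)"
      using U Ui Pi P B by (intro assoc_mult_mat[of _ n n _ n _ n]) auto
    also have "\<dots> = mat_inv U * B" using Pi Ui B by simp
    also have "U * (mat_inv U * B) = U * mat_inv U * B"
      using U Ui B by (intro assoc_mult_mat[of _ n n _ n _ n, symmetric]) auto
    also have "\<dots> = B" using Ui B by simp
    finally show ?thesis .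
  qed
  have inv_iff: "invertible_mat (D c) \<longleftrightarrow> invertible_mat (F c)" for c
  proof -
    have "det (H c) = det (mat_inv U) * det (D c) * det P"
      unfolding UDP[symmetric] using Ui(1) D[of c] P(1) by (simp add: det_mult[of _ n])
    moreover have "det (mat_inv U) \<noteq> 0"
      using Ui(2) det_mult[OF U(1) Ui(1)] by auto
    ultimately show ?thesis
      using detH[of c] P N unfolding invertible_mat_iff_det[OF D] invertible_mat_iff_det[OF F]
        invertible_mat_iff_det[OF P(1)] invertible_mat_iff_det[OF N(1)] by auto
  qed
  define c where "c = (SOME c. invertible_mat (D c))"
  have inv: "invertible_mat (D c)"
    using assms(4) someI_ex[of "\<lambda>c. invertible_mat (D c)"]
    unfolding regular_pencil_def c_def D_def by blast
  then have "invertible_mat (F c)" unfolding inv_iff .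
  note G = mat_inv[OF D inv] and Fi = mat_inv[OF F this]
  have index_E: "pencil_index E A = mat_index (mat_inv (D c) * E)"
    unfolding pencil_index_def Let_def c_def D_def ..
  \<comment> \<open>\<open>inv_iff\<close> rewrites the predicate under \<open>SOME\<close>, so this
    index is evaluated at the same \<open>c\<close>.\<close>
  have index_E1: "pencil_index E1 A1 = mat_index (mat_inv (F c) * E1)"
    unfolding pencil_index_def Let_def c_def inv_iff F_def ..

  \<comment> \<open>\<open>X\<close> and \<open>W\<close> undo \<open>U\<close> and \<open>P\<close>
    in the block factorization \<open>Z * V\<close>. \<open>Y\<close> solves
    \<open>D c * Y = X\<close>: multiply \<open>H c * Q = Z * F c\<close> by the inverse of
    \<open>F c\<close> on the right and undo the transformations.\<close>
  define X where "X = U * Z"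
  define W where "W = V * mat_inv P"
  define Y where "Y = P * (Q * mat_inv (F c))"
  have X: "X \<in> carrier_mat n r" and W: "W \<in> carrier_mat r n" and Y: "Y \<in> carrier_mat n r"
    and QF: "Q * mat_inv (F c) \<in> carrier_mat n r"
    unfolding X_def W_def Y_def using U Z V Pi P Q Fi by auto
  have E_eq: "E = X * W"
  proof -
    have "E = U * (Z * V) * mat_inv P"
      using recover[OF E] blocks(1)[OF STKL(3,4)] unfolding UEP by simp
    also have "U * (Z * V) = X * V" unfolding X_def using assoc_mult_mat[OF U(1) Z V] by simp
    also have "X * V * mat_inv P = X * W" unfolding W_def by (rule assoc_mult_mat[OF X V Pi(1)])
    finally show ?thesis .
  qed
  have UDY: "mat_inv U * D c * Y = Z"
  proof -
    have "mat_inv U * D c * Y = H c * (Q * mat_inv (F c))"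
      unfolding Y_def UDP[symmetric] using Ui(1) D P(1) QF
      by (intro assoc_mult_mat[of _ n n _ n _ r, symmetric]) auto
    also have "\<dots> = Z * F c * mat_inv (F c)"
      unfolding HQ[symmetric] by (rule assoc_mult_mat[OF H Q Fi(1), symmetric])
    also have "\<dots> = Z" using assoc_mult_mat[OF Z F[of c] Fi(1)] Fi(2) Z by simp
    finally show ?thesis .
  qed
  have "D c * Y = X"
  proof -
    have "X = U * (mat_inv U * (D c * Y))"
      unfolding X_def UDY[symmetric] using assoc_mult_mat[OF Ui(1) D Y] by simp
    also have "\<dots> = U * mat_inv U * (D c * Y)"
      by (rule assoc_mult_mat[OF U(1) Ui(1) mult_carrier_mat[OF D Y], symmetric])
    also have "\<dots> = D c * Y"
      unfolding Ui(2) by (rule left_mult_one_mat[OF mult_carrier_mat[OF D Y]])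
    finally show ?thesis ..
  qed
  then have "mat_inv (D c) * X = Y" using assoc_mult_mat[OF G(1) D[of c] Y] G(3) Y by simp
  then have YW: "mat_inv (D c) * E = Y * W"
    unfolding E_eq using assoc_mult_mat[OF G(1) X W] by simp
  have "W * Y = V * (mat_inv P * Y)" unfolding W_def by (rule assoc_mult_mat[OF V Pi(1) Y])
  also have "mat_inv P * Y = Q * mat_inv (F c)"
    unfolding Y_def assoc_mult_mat[OF Pi(1) P(1) QF, symmetric] Pi(3)
    by (rule left_mult_one_mat[OF QF])
  also have "V * (Q * mat_inv (F c)) = E1 * mat_inv (F c)"
    using assoc_mult_mat[OF V Q Fi(1)] blocks(3)[OF STKL(3,4)] unfolding E1 by simp
  \<comment> \<open>Inserting \<open>F c\<close> times its inverse exhibits \<open>W * Y\<close> as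
    a conjugate of \<open>mat_inv (F c) * E1\<close> by \<open>F c\<close>.\<close>
  also have "E1 = F c * (mat_inv (F c) * E1)"
    using assoc_mult_mat[OF F[of c] Fi(1) E1c] Fi(2) E1c by simp
  finally have WY: "W * Y = F c * (mat_inv (F c) * E1) * mat_inv (F c)" .
  obtain R where R: "R \<in> carrier_mat n r" "W * R = 1\<^sub>m r"
    using vec_space.rank_factorization_right_inverse[OF X W] r unfolding E_eq by metis
  \<comment> \<open>By \<open>UDY\<close>, \<open>mat_inv U * D c\<close> maps \<open>Y\<close> to
    \<open>Z\<close>, which has left inverse \<open>Z\<^sup>T\<close>.\<close>
  have left_inv: "Z\<^sup>T * (mat_inv U * D c) * Y = 1\<^sub>m r"
    using assoc_mult_mat[of "Z\<^sup>T" r n "mat_inv U * D c" n Y r] Z Ui D Y UDY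
      blocks(2)[OF STKL(3,4)] by simp
  have "det (mat_inv (D c) * E) = 0"
    using det_mult[OF G(1) E] assms(3) unfolding invertible_mat_iff_det[OF E] by simp
  then have sing: "\<not> invertible_mat (Y * W)"
    unfolding YW using invertible_mat_iff_det[OF mult_carrier_mat[OF Y W]] by simp
  have "pencil_index E A = Suc (mat_index (W * Y))"
    unfolding index_E YW using Z Ui(1) D
    by (intro mat_index_mult_swap[OF Y W _ left_inv R sing]) auto
  also have "mat_index (W * Y) = pencil_index E1 A1"
    unfolding WY index_E1 using Fi E1c by (intro mat_index_similar[OF _ F Fi(1)]) auto
  finally show ?thesis by simp
qed

end
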